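(* Let $K$ be a number field and let $S$ be a finite set of places of $K$ which includes all of the Archimedean places. Let $\mathcal{G}_2(K,S)$ be the set of all points $\langle\phi\rangle$ in $\mathcal{M}_2$ for maps $\phi\in\mathrm{Rat}_2(K)$ having good reduction at all places $v\in M_K\setminus S$. Then $\mathcal{G}_2(K,S)$ is Zariski-dense in $\mathcal{M}_2$.
   Context: $M_K$ is the set of places of the number field $K$, and $\bar K$ is an algebraic closure of $K$. For a non-Archimedean $v\in M_K$, $\mathcal{O}_v$ is the ring of $v$-integral elements of $K$, $\mathcal{O}_v^\times$ its unit group, and $\mathbb{F}_v$ its residue field. Quadratic rational maps. A quadratic rational map $\phi:\mathbb{P}^1\to\mathbb{P}^1$ over $\bar K$ is $\phi(X:Y)=(A(X,Y):B(X,Y))$ with $A=a_0X^2+a_1XY+a_2Y^2$, $B=b_0X^2+b_1XY+b_2Y^2$ having no common zero in $\bar K^2\setminus\{(0,0)\}$, equivalently $\mathrm{Res}(A,B)\neq 0$, where $\mathrm{Res}(A,B)$ is the determinant of the $4\times4$ matrix with rows $(a_0,a_1,a_2,0)$, $(0,a_0,a_1,a_2)$, $(b_0,b_1,b_2,0)$, $(0,b_0,b_1,b_2)$. The space $\mathrm{Rat}_2$ of all such maps is identified, via the coefficients, with the open affine subvariety $\{\mathrm{Res}(A,B)\ne0\}$ of $\mathbb{P}^5$; $\mathrm{Rat}_2(K)$ is the set of those maps defined over $K$. Moduli space. $\mathrm{PGL}_2$ acts on $\mathrm{Rat}_2$ by conjugation, $\phi^f=f^{-1}\circ\phi\circ f$.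 The moduli space is $\mathcal{M}_2=\mathrm{Rat}_2/\mathrm{PGL}_2=\mathrm{Spec}(\mathcal{A}^{\mathrm{PGL}_2})$, where $\mathcal{A}$ is the coordinate ring of $\mathrm{Rat}_2$; it is a geometric quotient whose quotient map is denoted $\phi\mapsto\langle\phi\rangle$ and whose geometric fibers are exactly the conjugation orbits. It is known (Milnor, Silverman) that $\langle\phi\rangle\mapsto(\sigma_1(\phi),\sigma_2(\phi))$ is an isomorphism $\mathcal{M}_2\simeq\mathbb{A}^2$, where $\sigma_1=\lambda_1+\lambda_2+\lambda_3$ and $\sigma_2=\lambda_1\lambda_2+\lambda_1\lambda_3+\lambda_2\lambda_3$ are the first two elementary symmetric functions of the multipliers $\lambda_1,\lambda_2,\lambda_3$ of the three fixed points of $\phi$ (counted with multiplicity), the multiplier of a fixed point $\alpha$ being $\phi'(\alpha)$ in an affine coordinate. Reduction. For $\phi\in\mathrm{Rat}_2(K)$ and a non-Archimedean place $v$, scale the coefficients of $(A,B)$ so that all lie in $\mathcal{O}_v$ and at least one lies in $\mathcal{O}_v^\times$; the reduced map $\tilde\phi_v:\mathbb{P}^1\to\mathbb{P}^1$ over $\mathbb{F}_v$ is defined by $\tilde\phi_v(X:Y)=(\tilde A(X,Y):\tilde B(X,Y))$ after cancelling any common factors. One has $\deg(\tilde\phi_v)\le 2$, with $\deg(\tilde\phi_v)=2$ if and only if $\mathrm{Res}(A,B)\in\mathcal{O}_v^\times$ for the scaled coefficients. Two maps $\phi,\psi\in\mathrm{Rat}_2(K)$ are $K$-isomorphic if $\psi=\phi^f$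 for some $f\in\mathrm{PGL}_2(K)$. A map $\phi\in\mathrm{Rat}_2(K)$ has good reduction at a non-Archimedean place $v$ if it is $K$-isomorphic to some $\psi\in\mathrm{Rat}_2(K)$ such that $\deg(\tilde\psi_v)=2$. *)

theory Defs
  imports "HOL-Analysis.Analysis" "HOL-Algebra.QuotRing" "HOL-Algebra.Algebraic_Closure_Type"
begin

(* fps_nth and vec_nth share the symbol $, which makes iterated indexing ambiguous *)
no_notation fps_nth (infixl \<open>$\<close> 75)

class number_field = field_char_0 +
  assumes finite_over_rat:
    "\<exists>B::'a set. finite B \<and> (\<forall>x. \<exists>c. x = (\<Sum>b\<in>B. of_rat (c b) * b))"

definition absolute_value :: "('k::field \<Rightarrow> real) \<Rightarrow> bool" where
  "absolute_value f \<longleftrightarrow>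
     (\<forall>x. 0 \<le> f x) \<and> (\<forall>x. f x = 0 \<longleftrightarrow> x = 0) \<and>
     (\<forall>x y. f (x * y) = f x * f y) \<and> (\<forall>x y. f (x + y) \<le> f x + f y)"

definition nontrivial_absolute_values :: "('k::field \<Rightarrow> real) set" where
  "nontrivial_absolute_values = {f. absolute_value f \<and> (\<exists>x. x \<noteq> 0 \<and> f x \<noteq> 1)}"

definition equivalent_absolute_values :: "(('k::field \<Rightarrow> real) \<times> ('k \<Rightarrow> real)) set" where
  "equivalent_absolute_values =
     {(f, g). f \<in> nontrivial_absolute_values \<and> g \<in> nontrivial_absolute_values \<and>
        (\<exists>s>0. \<forall>x. g x = f x powr s)}"

type_synonym 'k place = "('k \<Rightarrow> real) set"

definition places :: "('k::number_field) place set" where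
  "places = nontrivial_absolute_values // equivalent_absolute_values"

definition archimedean :: "('k::field) place \<Rightarrow> bool" where
  "archimedean v \<longleftrightarrow> \<not> (\<forall>f\<in>v. \<forall>x y. f (x + y) \<le> max (f x) (f y))"

text \<open>The following are only meaningful at non-Archimedean places.\<close>

definition integers_at :: "('k::field) place \<Rightarrow> 'k set" where
  "integers_at v = {x. \<forall>f\<in>v. f x \<le> 1}"

definition units_at :: "('k::field) place \<Rightarrow> 'k set" where
  "units_at v = {x \<in> integers_at v. x \<noteq> 0 \<and> inverse x \<in> integers_at v}"

definition valuation_ring :: "('k::field) place \<Rightarrow> 'k ring" where
  "valuation_ring v = ring_of_type_algebra\<lparr>carrier := integers_at v\<rparr>"

definition maximal_ideal_at :: "('k::field) place \<Rightarrow> 'k set" where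
  "maximal_ideal_at v = integers_at v - units_at v"

definition residue_field :: "('k::field) place \<Rightarrow> 'k set ring" where
  "residue_field v = valuation_ring v Quot maximal_ideal_at v"

definition residue_at :: "('k::field) place \<Rightarrow> 'k \<Rightarrow> 'k set" where
  "residue_at v x = maximal_ideal_at v +>\<^bsub>valuation_ring v\<^esub> x"

text \<open>
  A pair of binary quadratic forms $A = a_0 X^2 + a_1 XY + a_2 Y^2$ and
  $B = b_0 X^2 + b_1 XY + b_2 Y^2$ is given by its $2 \times 3$ coefficient matrix,
  with rows $(a_0, a_1, a_2)$ and $(b_0, b_1, b_2)$, so that
  $(A, B)^T$ is this matrix times the column $(X^2, XY, Y^2)^T$.
\<close>

type_synonym 'a forms = "'a^3^2"

definition resultant :: "('a::field) forms \<Rightarrow> 'a" where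
  "resultant q = det (vector
     [vector [q$1$1, q$1$2, q$1$3, 0],
      vector [0, q$1$1, q$1$2, q$1$3],
      vector [q$2$1, q$2$2, q$2$3, 0],
      vector [0, q$2$1, q$2$2, q$2$3]] :: 'a^4^4)"

text \<open>
  A rational map is a point of $\mathbf{P}^5$, represented by the set of all its homogeneous
  coordinate vectors.
\<close>

type_synonym 'a qmap = "'a forms set"

definition proj_point :: "('a::field) forms \<Rightarrow> 'a qmap" where
  "proj_point q = {(\<chi> i j. c * q$i$j) | c. c \<noteq> 0}"

definition Rat2 :: "('a::field) qmap set" where
  "Rat2 = proj_point ` {q. resultant q \<noteq> 0}"

text \<open>
  For $f = (\alpha X + \beta Y : \gamma X + \delta Y)$, the matrix \<open>sym2 f\<close> expresses the column
  $((\alpha X + \beta Y)^2, (\alpha X + \beta Y)(\gamma X + \delta Y), (\gamma X + \delta Y)^2)^T$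
  in terms of $(X^2, XY, Y^2)^T$; hence \<open>q ** sym2 f\<close> is the coefficient matrix of the composite
  $(A, B) \circ f$.
\<close>

definition sym2 :: "('a::field)^2^2 \<Rightarrow> 'a^3^3" where
  "sym2 f = (let \<alpha> = f$1$1; \<beta> = f$1$2; \<gamma> = f$2$1; \<delta> = f$2$2 in vector
     [vector [\<alpha>\<^sup>2, 2 * \<alpha> * \<beta>, \<beta>\<^sup>2],
      vector [\<alpha> * \<gamma>, \<alpha> * \<delta> + \<beta> * \<gamma>, \<beta> * \<delta>],
      vector [\<gamma>\<^sup>2, 2 * \<gamma> * \<delta>, \<delta>\<^sup>2]])"

text \<open>
  The map $f^{-1} \circ \phi \circ f$. Elements of $\mathrm{PGL}_2$ are represented by invertible
  matrices; scalar matrices act trivially on points of $\mathbf{P}^5$.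
\<close>

definition conjugate :: "('a::field)^2^2 \<Rightarrow> 'a qmap \<Rightarrow> 'a qmap" where
  "conjugate f \<phi> = (\<lambda>q. matrix_inv f ** q ** sym2 f) ` \<phi>"

definition isomorphic_maps :: "('a::field) qmap \<Rightarrow> 'a qmap \<Rightarrow> bool" where
  "isomorphic_maps \<phi> \<psi> \<longleftrightarrow> (\<exists>f. invertible f \<and> \<psi> = conjugate f \<phi>)"

text \<open>
  A binary form $\sum_{i \le d} c_i X^{d-i} Y^i$ of degree $d$ over a ring is given by its
  coefficient sequence, extended by zero.
\<close>

definition binary_forms :: "('r, 'm) ring_scheme \<Rightarrow> nat \<Rightarrow> (nat \<Rightarrow> 'r) set" where
  "binary_forms R d = {c. (\<forall>i\<le>d. c i \<in> carrier R) \<and> (\<forall>i>d. c i = \<zero>\<^bsub>R\<^esub>)}"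

definition form_mult ::
    "('r, 'm) ring_scheme \<Rightarrow> (nat \<Rightarrow> 'r) \<Rightarrow> (nat \<Rightarrow> 'r) \<Rightarrow> nat \<Rightarrow> 'r" where
  "form_mult R c d = (\<lambda>k. \<Oplus>\<^bsub>R\<^esub>i\<in>{..k}. c i \<otimes>\<^bsub>R\<^esub> d (k - i))"

definition common_factor_degrees ::
    "('r, 'm) ring_scheme \<Rightarrow> (nat \<Rightarrow> 'r) \<Rightarrow> (nat \<Rightarrow> 'r) \<Rightarrow> nat set" where
  "common_factor_degrees R A B =
     {e. e \<le> 2 \<and> (\<exists>G\<in>binary_forms R e. \<exists>A'\<in>binary_forms R (2 - e). \<exists>B'\<in>binary_forms R (2 - e).
            A = form_mult R G A' \<and> B = form_mult R G B')}"

text \<open>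
  The degree of the map $(A : B)$ for quadratic forms $A$, $B$, not both zero, over a field:
  cancelling a common factor of maximal degree $e$ leaves coprime forms of degree $2 - e$.
\<close>

definition map_degree :: "('r, 'm) ring_scheme \<Rightarrow> (nat \<Rightarrow> 'r) \<Rightarrow> (nat \<Rightarrow> 'r) \<Rightarrow> nat" where
  "map_degree R A B = 2 - Max (common_factor_degrees R A B)"

definition normalized_at :: "('k::field) place \<Rightarrow> 'k forms \<Rightarrow> bool" where
  "normalized_at v q \<longleftrightarrow> (\<forall>i j. q$i$j \<in> integers_at v) \<and> (\<exists>i j. q$i$j \<in> units_at v)"

definition reduced_form :: "('k::field) place \<Rightarrow> 'k^3 \<Rightarrow> nat \<Rightarrow> 'k set" where
  "reduced_form v r = (\<lambda>_. \<zero>\<^bsub>residue_field v\<^esub>)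
     (0 := residue_at v (r$1), 1 := residue_at v (r$2), 2 := residue_at v (r$3))"

text \<open>
  Two normalized coordinate vectors of the same map differ by a factor in the unit group at
  \<open>v\<close>, so the degree of the reduced map does not depend on the choice.
\<close>

definition reduction_degree :: "('k::field) place \<Rightarrow> 'k qmap \<Rightarrow> nat" where
  "reduction_degree v \<psi> = (let q = (SOME q. q \<in> \<psi> \<and> normalized_at v q) in
     map_degree (residue_field v) (reduced_form v (q$1)) (reduced_form v (q$2)))"

definition good_reduction :: "('k::field) place \<Rightarrow> 'k qmap \<Rightarrow> bool" where
  "good_reduction v \<phi> \<longleftrightarrow>
     (\<exists>\<psi>\<in>Rat2. isomorphic_maps \<phi> \<psi> \<and> reduction_degree v \<psi> = 2)"

definition homogeneous_poly :: "nat \<Rightarrow> (('a::field) forms \<Rightarrow> 'a) \<Rightarrow> bool" where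
  "homogeneous_poly d P \<longleftrightarrow>
     (\<exists>(M :: (nat^3^2) set) c. finite M \<and> (\<forall>m\<in>M. (\<Sum>i\<in>UNIV. \<Sum>j\<in>UNIV. m$i$j) = d) \<and>
        P = (\<lambda>q. \<Sum>m\<in>M. c m * (\<Prod>i\<in>UNIV. \<Prod>j\<in>UNIV. (q$i$j) ^ (m$i$j))))"

text \<open>
  The coordinate ring of the principal affine open subset of $\mathbf{P}^5$ on which the resultant
  (a form of degree 4) does not vanish consists of the quotients $P / \mathrm{Res}^n$ with $P$
  homogeneous of degree $4n$. It is realised as a ring of functions on \<open>Rat2\<close>, which is faithful
  over an algebraically closed field.
\<close>

definition regular_functions :: "(('a::alg_closed_field) qmap \<Rightarrow> 'a) set" where
  "regular_functions = {F \<in> extensional Rat2.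
     \<exists>n P. homogeneous_poly (4 * n) P \<and>
       (\<forall>q. resultant q \<noteq> 0 \<longrightarrow> F (proj_point q) = P q / resultant q ^ n)}"

definition PGL2_invariants :: "(('a::alg_closed_field) qmap \<Rightarrow> 'a) set" where
  "PGL2_invariants = {F \<in> regular_functions.
     \<forall>f. invertible f \<longrightarrow> (\<forall>\<phi>\<in>Rat2. F (conjugate f \<phi>) = F \<phi>)}"

definition invariant_ring :: "(('a::alg_closed_field) qmap \<Rightarrow> 'a) ring" where
  "invariant_ring = \<lparr>carrier = PGL2_invariants,
     monoid.mult = (\<lambda>F G. \<lambda>\<phi>\<in>Rat2. F \<phi> * G \<phi>), one = (\<lambda>\<phi>\<in>Rat2. 1),
     ring.zero = (\<lambda>\<phi>\<in>Rat2. 0), add = (\<lambda>F G. \<lambda>\<phi>\<in>Rat2. F \<phi> + G \<phi>)\<rparr>"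

definition spec :: "('r, 'm) ring_scheme \<Rightarrow> 'r set set" where
  "spec R = {p. primeideal p R}"

definition zariski_topology :: "('r, 'm) ring_scheme \<Rightarrow> 'r set topology" where
  "zariski_topology R = topology (\<lambda>U. \<exists>E\<subseteq>carrier R. U = spec R - {p \<in> spec R. E \<subseteq> p})"

lemma istopology_zariski:
  "istopology (\<lambda>U. \<exists>E\<subseteq>carrier R. U = spec R - {p \<in> spec R. E \<subseteq> p})"
  unfolding istopology_def
proof (intro conjI allI impI)
  fix U V
  assume "\<exists>E\<subseteq>carrier R. U = spec R - {p \<in> spec R. E \<subseteq> p}"
    and "\<exists>E\<subseteq>carrier R. V = spec R - {p \<in> spec R. E \<subseteq> p}"
  then obtain E E' where E: "E \<subseteq> carrier R" "U = spec R - {p \<in> spec R. E \<subseteq> p}"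
    and E': "E' \<subseteq> carrier R" "V = spec R - {p \<in> spec R. E' \<subseteq> p}" by blast
  show "\<exists>E\<subseteq>carrier R. U \<inter> V = spec R - {p \<in> spec R. E \<subseteq> p}"
  proof (cases "spec R = {}")
    case True
    then have "U \<inter> V = spec R - {p \<in> spec R. {} \<subseteq> p}" using E(2) by simp
    then show ?thesis by (intro exI[of _ "{}"]) simp
  next
    case False
    then obtain p where "primeideal p R" by (auto simp: spec_def)
    then interpret cring R by (rule primeideal.axioms(2))
    have "e \<otimes>\<^bsub>R\<^esub> e' \<in> p \<longleftrightarrow> e \<in> p \<or> e' \<in> p"
      if "p \<in> spec R" "e \<in> E" "e' \<in> E'" for p e e'
    proof -
      interpret primeideal p R using that by (simp add: spec_def)
      have "e \<in> carrier R" "e' \<in> carrier R" using that E(1) E'(1) by blast+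
      then show ?thesis using I_prime I_l_closed I_r_closed by metis
    qed
    then have "U \<inter> V = spec R - {p \<in> spec R. {e \<otimes>\<^bsub>R\<^esub> e' | e e'. e \<in> E \<and> e' \<in> E'} \<subseteq> p}"
      unfolding E(2) E'(2) by blast
    moreover have "{e \<otimes>\<^bsub>R\<^esub> e' | e e'. e \<in> E \<and> e' \<in> E'} \<subseteq> carrier R"
      using E(1) E'(1) by blast
    ultimately show ?thesis by blast
  qed
next
  fix \<K>
  assume "\<forall>U\<in>\<K>. \<exists>E\<subseteq>carrier R. U = spec R - {p \<in> spec R. E \<subseteq> p}"
  then obtain E where E: "\<And>U. U \<in> \<K> \<Longrightarrow> E U \<subseteq> carrier R"
    "\<And>U. U \<in> \<K> \<Longrightarrow> U = spec R - {p \<in> spec R. E U \<subseteq> p}" by metis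
  have "\<Union>\<K> = spec R - {p \<in> spec R. \<Union>(E ` \<K>) \<subseteq> p}" (is "?l = ?r")
  proof (rule Set.set_eqI)
    fix p
    have "p \<in> \<Union>\<K> \<longleftrightarrow> (\<exists>U\<in>\<K>. p \<in> spec R - {p \<in> spec R. E U \<subseteq> p})"
      using E(2) by (metis Union_iff)
    then show "p \<in> ?l \<longleftrightarrow> p \<in> ?r" by blast
  qed
  moreover have "\<Union>(E ` \<K>) \<subseteq> carrier R" using E(1) by blast
  ultimately show "\<exists>E\<subseteq>carrier R. \<Union>\<K> = spec R - {p \<in> spec R. E \<subseteq> p}" by blast
qed

text \<open>
  The moduli space over an algebraically closed field; as a topological space it carries the
  non-closed points of the spectrum as well.
\<close>

definition moduli_space :: "(('a::alg_closed_field) qmap \<Rightarrow> 'a) set topology" where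
  "moduli_space = zariski_topology invariant_ring"

text \<open>The closed point $\langle\phi\rangle$: the kernel of evaluation at $\phi$.\<close>

definition moduli_point :: "('a::alg_closed_field) qmap \<Rightarrow> ('a qmap \<Rightarrow> 'a) set" where
  "moduli_point \<phi> = {F \<in> PGL2_invariants. F \<phi> = 0}"

definition base_change :: "('k::field) qmap \<Rightarrow> 'k alg_closure qmap" where
  "base_change \<phi> = (\<Union>q\<in>\<phi>. proj_point (\<chi> i j. to_ac (q$i$j)))"

definition good_reduction_locus ::
    "('k::number_field) place set \<Rightarrow> ('k alg_closure qmap \<Rightarrow> 'k alg_closure) set set" where
  "good_reduction_locus S =
     {moduli_point (base_change \<phi>) | \<phi>. \<phi> \<in> Rat2 \<and> (\<forall>v\<in>places - S. good_reduction v \<phi>)}"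

end

theory Submission
  imports Defs
begin

text \<open>
  Consider the maps $\phi_g = g \circ (X^2 : Y^2) = (aX^2 + bY^2 : cX^2 + dY^2)$, where
  $g$ has rows $(a, b)$, $(c, d)$ and determinant 1. If the entries of $g$ are integers, then
  $\phi_g$ has good reduction at every non-Archimedean place, since the determinant stays a unit
  modulo every prime (\<open>good_reduction_diagonal_forms\<close>). The claim is that the points
  $\langle\phi_g\rangle$ with $g \in \mathrm{SL}_2(\mathbf{Z})$ are already Zariski-dense. There are
  two reasons.

  Over an algebraically closed field of characteristic 0, every quadratic map has two distinct
  critical points. After moving them to $0$ and $\infty$, both forms lose their middle term, and
  the map becomes some $\phi_g$ with $\det g = 1$ after scaling (\<open>conjugate_to_diagonal\<close>). Hence
  $g \mapsto \langle\phi_g\rangle$ is a surjection from $\mathrm{SL}_2$ onto the moduli space.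

  The group $\mathrm{SL}_2(\mathbf{Z})$ is Zariski-dense in $\mathrm{SL}_2$, because every matrix of
  determinant 1 is a product of four elementary matrices, and a polynomial in four parameters which
  vanishes at all integers is zero (\<open>homogeneous_poly_vanishes_on_SL2\<close>).

  Together these say that an invariant regular function which vanishes at all $\phi_g$ with
  $g \in \mathrm{SL}_2(\mathbf{Z})$ is zero (\<open>invariant_vanishes\<close>). In the prime spectrum of the
  invariant ring this is the density of the corresponding closed points
  (\<open>zariski_dense_if_vanishing_trivial\<close>).
\<close>

section \<open>Resultants and coordinate changes of quadratic forms\<close>

text \<open>
  The maps $(aX^2 + bY^2 : cX^2 + dY^2)$, that is, the squaring map followed by the linear fractional map
  with matrix rows $(a, b)$ and $(c, d)$; their critical points are $(1 : 0)$ and $(0 : 1)$.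
\<close>

definition diagonal_forms :: "'a \<Rightarrow> 'a \<Rightarrow> 'a \<Rightarrow> 'a \<Rightarrow> ('a::field) forms" where
  "diagonal_forms a b c d = vector [vector [a, 0, b], vector [c, 0, d]]"

lemma diagonal_forms_nth [simp]:
  "diagonal_forms a b c d $ 1 $ 1 = a" "diagonal_forms a b c d $ 1 $ 2 = 0"
  "diagonal_forms a b c d $ 1 $ 3 = b" "diagonal_forms a b c d $ 2 $ 1 = c"
  "diagonal_forms a b c d $ 2 $ 2 = 0" "diagonal_forms a b c d $ 2 $ 3 = d"
  by (simp_all add: diagonal_forms_def)

lemma forms_eq_iff:
  "(q :: 'a forms) = r \<longleftrightarrow> q$1$1 = r$1$1 \<and> q$1$2 = r$1$2 \<and> q$1$3 = r$1$3 \<and>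
     q$2$1 = r$2$1 \<and> q$2$2 = r$2$2 \<and> q$2$3 = r$2$3"
  by (auto simp: vec_eq_iff forall_2 forall_3)

lemma det_4:
  fixes A :: "'a::comm_ring_1^4^4"
  shows "det A =
    A$1$1 * (A$2$2 * (A$3$3 * A$4$4 - A$3$4 * A$4$3) - A$2$3 * (A$3$2 * A$4$4 - A$3$4 * A$4$2)
      + A$2$4 * (A$3$2 * A$4$3 - A$3$3 * A$4$2))
    - A$1$2 * (A$2$1 * (A$3$3 * A$4$4 - A$3$4 * A$4$3) - A$2$3 * (A$3$1 * A$4$4 - A$3$4 * A$4$1)
      + A$2$4 * (A$3$1 * A$4$3 - A$3$3 * A$4$1))
    + A$1$3 * (A$2$1 * (A$3$2 * A$4$4 - A$3$4 * A$4$2) - A$2$2 * (A$3$1 * A$4$4 - A$3$4 * A$4$1)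
      + A$2$4 * (A$3$1 * A$4$2 - A$3$2 * A$4$1))
    - A$1$4 * (A$2$1 * (A$3$2 * A$4$3 - A$3$3 * A$4$2) - A$2$2 * (A$3$1 * A$4$3 - A$3$3 * A$4$1)
      + A$2$3 * (A$3$1 * A$4$2 - A$3$2 * A$4$1))"
proof -
  have f1: "finite {2::4, 3, 4}" "1 \<notin> {2::4, 3, 4}" by auto
  have f2: "finite {3::4, 4}" "2 \<notin> {3::4, 4}" by auto
  have f3: "finite {4::4}" "3 \<notin> {4::4}" by auto
  show ?thesis
    unfolding det_def UNIV_4
    unfolding sum_over_permutations_insert[OF f1]
    unfolding sum_over_permutations_insert[OF f2]
    unfolding sum_over_permutations_insert[OF f3]
    unfolding permutes_sing
    by (simp add: sign_swap_id permutation_swap_id permutation_compose sign_compose sign_id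
        swap_id_eq algebra_simps)
qed

text \<open>
  Expanding the $4 \times 4$ determinant by its first and third against its second and fourth
  rows leaves an expression in the three $2 \times 2$ minors $m_{01}, m_{02}, m_{12}$ of the
  coefficient matrix. Up to a factor, $m_{02}^2 - m_{01} m_{12}$ is the discriminant of the
  Jacobian form $m_{01} X^2 + 2 m_{02} XY + m_{12} Y^2$, half the Jacobian determinant of $(A, B)$,
  whose zeros are the critical points.
\<close>

lemma resultant_eq:
  "resultant q = (q$1$1 * q$2$3 - q$1$3 * q$2$1)\<^sup>2
     - (q$1$1 * q$2$2 - q$1$2 * q$2$1) * (q$1$2 * q$2$3 - q$1$3 * q$2$2)"
proof -
  have v4: "(vector [x, y, z, w] :: 'b^4) $ 1 = x" "(vector [x, y, z, w] :: 'b^4) $ 2 = y"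
    "(vector [x, y, z, w] :: 'b^4) $ 3 = z" "(vector [x, y, z, w] :: 'b^4) $ 4 = w"
    for x y z w :: "'b::zero"
    by (simp_all add: vector_def)
  show ?thesis
    unfolding resultant_def det_4 v4 by (simp add: algebra_simps power2_eq_square)
qed

text \<open>
  Each minor of \<open>g ** q\<close> is the corresponding minor of \<open>q\<close> times the determinant of \<open>g\<close>.
\<close>

lemma resultant_postcompose: "resultant (g ** q) = (det g)\<^sup>2 * resultant q"
proof -
  have minor: "(\<alpha> * x + \<beta> * y) * (\<gamma> * z + \<delta> * w) - (\<alpha> * z + \<beta> * w) * (\<gamma> * x + \<delta> * y)
      = (\<alpha> * \<delta> - \<beta> * \<gamma>) * (x * w - z * y)" for \<alpha> \<beta> \<gamma> \<delta> x y z w :: 'a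
    by Groebner_Basis.algebra
  have "(D * m02)\<^sup>2 - (D * m01) * (D * m12) = D\<^sup>2 * (m02\<^sup>2 - m01 * m12)" for D m01 m02 m12 :: 'a
    by Groebner_Basis.algebra
  then show ?thesis
    unfolding resultant_eq det_2 by (simp add: matrix_matrix_mult_def sum_2 minor)
qed

text \<open>
  The Jacobian form of \<open>q ** sym2 f\<close> is the Jacobian form of \<open>q\<close>, composed with \<open>f\<close> and
  multiplied by the determinant of \<open>f\<close>; substituting \<open>f\<close> into a binary quadratic form
  multiplies its discriminant by the square of that determinant.
\<close>

lemma resultant_precompose: "resultant (q ** sym2 f) = det f ^ 4 * resultant q"
proof -
  define \<alpha> \<beta> \<gamma> \<delta> where "\<alpha> = f$1$1" and "\<beta> = f$1$2" and "\<gamma> = f$2$1" and "\<delta> = f$2$2"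
  define a0 a1 a2 b0 b1 b2 where "a0 = q$1$1" and "a1 = q$1$2" and "a2 = q$1$3"
    and "b0 = q$2$1" and "b1 = q$2$2" and "b2 = q$2$3"
  note defs = \<alpha>_def \<beta>_def \<gamma>_def \<delta>_def a0_def a1_def a2_def b0_def b1_def b2_def
  define m01 m02 m12 D where "m01 = a0 * b1 - a1 * b0" and "m02 = a0 * b2 - a2 * b0"
    and "m12 = a1 * b2 - a2 * b1" and "D = \<alpha> * \<delta> - \<beta> * \<gamma>"
  note m_defs = m01_def m02_def m12_def D_def
  define a0' a1' a2' where "a0' = a0 * \<alpha>\<^sup>2 + a1 * (\<alpha> * \<gamma>) + a2 * \<gamma>\<^sup>2"
    and "a1' = a0 * (2 * \<alpha> * \<beta>) + a1 * (\<alpha> * \<delta> + \<beta> * \<gamma>) + a2 * (2 * \<gamma> * \<delta>)"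
    and "a2' = a0 * \<beta>\<^sup>2 + a1 * (\<beta> * \<delta>) + a2 * \<delta>\<^sup>2"
  define b0' b1' b2' where "b0' = b0 * \<alpha>\<^sup>2 + b1 * (\<alpha> * \<gamma>) + b2 * \<gamma>\<^sup>2"
    and "b1' = b0 * (2 * \<alpha> * \<beta>) + b1 * (\<alpha> * \<delta> + \<beta> * \<gamma>) + b2 * (2 * \<gamma> * \<delta>)"
    and "b2' = b0 * \<beta>\<^sup>2 + b1 * (\<beta> * \<delta>) + b2 * \<delta>\<^sup>2"
  note defs' = a0'_def a1'_def a2'_def b0'_def b1'_def b2'_def
  have factor: "(D * x)\<^sup>2 - (D * y) * (D * z) = D\<^sup>2 * (x\<^sup>2 - y * z)"
    and square: "D\<^sup>2 * (D\<^sup>2 * x) = D ^ 4 * x" for x y z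
    by (simp_all add: algebra_simps power2_eq_square power4_eq_xxxx)
  have "a0' * b1' - a1' * b0' = D * (m01 * \<alpha>\<^sup>2 + 2 * m02 * \<alpha> * \<gamma> + m12 * \<gamma>\<^sup>2)"
    unfolding defs' m_defs by Groebner_Basis.algebra
  moreover have "a1' * b2' - a2' * b1' = D * (m01 * \<beta>\<^sup>2 + 2 * m02 * \<beta> * \<delta> + m12 * \<delta>\<^sup>2)"
    unfolding defs' m_defs by Groebner_Basis.algebra
  moreover have "a0' * b2' - a2' * b0'
      = D * (m01 * \<alpha> * \<beta> + m02 * (\<alpha> * \<delta> + \<beta> * \<gamma>) + m12 * \<gamma> * \<delta>)"
    unfolding defs' m_defs by Groebner_Basis.algebra
  moreover have "(m01 * \<alpha> * \<beta> + m02 * (\<alpha> * \<delta> + \<beta> * \<gamma>) + m12 * \<gamma> * \<delta>)\<^sup>2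
      - (m01 * \<alpha>\<^sup>2 + 2 * m02 * \<alpha> * \<gamma> + m12 * \<gamma>\<^sup>2) * (m01 * \<beta>\<^sup>2 + 2 * m02 * \<beta> * \<delta> + m12 * \<delta>\<^sup>2)
      = D\<^sup>2 * (m02\<^sup>2 - m01 * m12)"
    unfolding D_def by Groebner_Basis.algebra
  ultimately have "(a0' * b2' - a2' * b0')\<^sup>2 - (a0' * b1' - a1' * b0') * (a1' * b2' - a2' * b1')
      = D ^ 4 * (m02\<^sup>2 - m01 * m12)"
    by (simp only: factor square)
  moreover have "(q ** sym2 f)$1$1 = a0'" "(q ** sym2 f)$1$2 = a1'" "(q ** sym2 f)$1$3 = a2'"
    "(q ** sym2 f)$2$1 = b0'" "(q ** sym2 f)$2$2 = b1'" "(q ** sym2 f)$2$3 = b2'"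
    unfolding defs' defs by (simp_all add: matrix_matrix_mult_def sum_3 sym2_def Let_def)
  moreover have "det f = D" "resultant q = m02\<^sup>2 - m01 * m12"
    by (simp_all add: resultant_eq det_2 m_defs defs)
  ultimately show ?thesis by (simp only: resultant_eq[of "q ** sym2 f"])
qed

lemma resultant_diagonal_forms: "resultant (diagonal_forms a b c d) = (a * d - b * c)\<^sup>2"
  by (simp add: resultant_eq)

lemma proj_point_scale:
  assumes "c \<noteq> 0"
  shows "proj_point (\<chi> i j. c * q$i$j) = proj_point q"
proof -
  have "\<exists>e. (\<chi> i j. d * q$i$j) = (\<chi> i j. e * (c * q$i$j)) \<and> e \<noteq> 0" if "d \<noteq> 0" for d
    using that assms by (intro exI[of _ "d / c"]) (simp add: field_simps)
  moreover have "\<exists>e. (\<chi> i j. d * (c * q$i$j)) = (\<chi> i j. e * q$i$j) \<and> e \<noteq> 0" if "d \<noteq> 0" for d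
    using that assms by (intro exI[of _ "d * c"]) (simp add: mult.assoc)
  ultimately show ?thesis unfolding proj_point_def by auto
qed

lemma conjugate_proj_point:
  "conjugate f (proj_point q) = proj_point (matrix_inv f ** q ** sym2 f)"
proof -
  have *: "g ** (\<chi> i j. c * q$i$j) ** h = (\<chi> i j. c * (g ** q ** h)$i$j)" for g h c
    by (simp add: matrix_matrix_mult_def vec_eq_iff sum_distrib_left sum_distrib_right mult_ac)
  show ?thesis
    unfolding conjugate_def proj_point_def by (simp add: setcompr_eq_image image_image *)
qed

lemma matrix_inv_left: "invertible f \<Longrightarrow> matrix_inv f ** f = mat 1"
  unfolding matrix_inv_def invertible_def by (rule someI2_ex) auto

section \<open>Normal form: critical points at zero and infinity\<close>

text \<open>
  The columns of \<open>f\<close> are the two zeros of the Jacobian form. The middle coefficient of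
  $A \circ f$ is the value of the polar form of $A$ at these two points, and likewise for $B$.
  The quadratic forms apolar to both $A$ and $B$ are the multiples of the Jacobian form, so
  these values vanish; the two zeros are distinct because the discriminant is the resultant.
\<close>

lemma critical_points_exist:
  fixes q :: "('a::{alg_closed_field, field_char_0}) forms"
  assumes "resultant q \<noteq> 0"
  obtains f where "det f \<noteq> 0" and "\<And>i. (q ** sym2 f) $ i $ 2 = 0"
proof -
  define m01 m02 m12 where "m01 = q$1$1 * q$2$2 - q$1$2 * q$2$1"
    and "m02 = q$1$1 * q$2$3 - q$1$3 * q$2$1" and "m12 = q$1$2 * q$2$3 - q$1$3 * q$2$2"
  note m_defs = m01_def m02_def m12_def
  have res: "resultant q = m02\<^sup>2 - m01 * m12" by (simp add: resultant_eq m_defs)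
  have mid: "(q ** sym2 f) $ i $ 2 = q$i$1 * (2 * f$1$1 * f$1$2)
      + q$i$2 * (f$1$1 * f$2$2 + f$1$2 * f$2$1) + q$i$3 * (2 * f$2$1 * f$2$2)" for f i
    by (simp add: matrix_matrix_mult_def sym2_def sum_3 Let_def)
  show thesis
  proof (cases "m01 = 0")
    case True
    \<comment> \<open>Here $(1 : 0)$ is a critical point, and the other one solves $2 m_{02} X + m_{12} Y = 0$.\<close>
    define f :: "'a^2^2" where "f = vector [vector [1, - m12], vector [0, 2 * m02]]"
    show thesis
    proof (rule that[of f])
      show "det f \<noteq> 0" using True res assms by (simp add: f_def det_2)
      have "(q ** sym2 f) $ 1 $ 2 = 0" "(q ** sym2 f) $ 2 $ 2 = 0"
        using True unfolding mid f_def m_defs by (simp_all add: algebra_simps)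
      then show "(q ** sym2 f) $ i $ 2 = 0" for i by (metis exhaust_2)
    qed
  next
    case False
    obtain r where r: "r\<^sup>2 = resultant q" using nth_root_exists[of 2] by auto
    \<comment> \<open>The quadratic formula, with the denominator \<open>m01\<close> moved to the second coordinate.\<close>
    define f :: "'a^2^2" where
      "f = vector [vector [- m02 + r, - m02 - r], vector [m01, m01]]"
    show thesis
    proof (rule that[of f])
      have "det f = 2 * r * m01" by (simp add: f_def det_2 algebra_simps)
      then show "det f \<noteq> 0" using False r assms by auto
      have "(q ** sym2 f) $ i $ 2 = 2 * m01 * (q$i$1 * m12 - q$i$2 * m02 + q$i$3 * m01)" for i
        using r unfolding mid f_def res by simp Groebner_Basis.algebra
      moreover have "q$1$1 * m12 - q$1$2 * m02 + q$1$3 * m01 = 0"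
        "q$2$1 * m12 - q$2$2 * m02 + q$2$3 * m01 = 0"
        unfolding m_defs by (simp_all add: algebra_simps)
      ultimately have "(q ** sym2 f) $ 1 $ 2 = 0" "(q ** sym2 f) $ 2 $ 2 = 0" by simp_all
      then show "(q ** sym2 f) $ i $ 2 = 0" for i by (metis exhaust_2)
    qed
  qed
qed

text \<open>
  Conjugating by \<open>f\<close> also composes with its inverse on the left. This only takes linear combinations
  of the two forms, so their middle coefficients remain zero, and the resultant, which stays
  nonzero, is then the square of the determinant of the remaining coefficients.
\<close>

lemma conjugate_to_diagonal:
  fixes \<phi> :: "('a::{alg_closed_field, field_char_0}) qmap"
  assumes "\<phi> \<in> Rat2"
  obtains f a b c d where "invertible f" "a * d - b * c = 1"
    "conjugate f \<phi> = proj_point (diagonal_forms a b c d)"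
proof -
  obtain q where q: "resultant q \<noteq> 0" "\<phi> = proj_point q" using assms by (auto simp: Rat2_def)
  obtain f where f: "det f \<noteq> 0" "\<And>i. (q ** sym2 f) $ i $ 2 = 0"
    using critical_points_exist[OF q(1)] by blast
  have inv: "invertible f" using f(1) by (simp add: invertible_det_nz)
  define q' where "q' = matrix_inv f ** q ** sym2 f"
  have "det (matrix_inv f) \<noteq> 0"
    using arg_cong[OF matrix_inv_left[OF inv], of det] by (auto simp: det_mul)
  then have res': "resultant q' \<noteq> 0"
    using q(1) f(1) by (simp add: q'_def resultant_precompose resultant_postcompose)
  have "q' $ i $ 2 = 0" for i
  proof -
    have "q' $ i $ 2 = (\<Sum>k\<in>UNIV. matrix_inv f $ i $ k * (q ** sym2 f) $ k $ 2)"
      unfolding q'_def matrix_mul_assoc[symmetric] by (simp add: matrix_matrix_mult_def)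
    then show ?thesis by (simp add: f(2))
  qed
  then have q': "q' = diagonal_forms (q'$1$1) (q'$1$3) (q'$2$1) (q'$2$3)"
    by (simp add: forms_eq_iff)
  define D where "D = q'$1$1 * q'$2$3 - q'$1$3 * q'$2$1"
  have "D \<noteq> 0" using res' q' resultant_diagonal_forms by (metis D_def zero_power2)
  obtain r where r: "r\<^sup>2 = D" using nth_root_exists[of 2] by auto
  with \<open>D \<noteq> 0\<close> have "r \<noteq> 0" by auto
  \<comment> \<open>Scaling the coefficient vector by \<open>e\<close> changes the determinant to 1 and keeps the map.\<close>
  define e where "e = inverse r"
  have "e \<noteq> 0" "e * e * D = 1"
    using \<open>r \<noteq> 0\<close> r by (auto simp: e_def power2_eq_square field_simps)
  show thesis
  proof (rule that[OF inv])
    show "(e * q'$1$1) * (e * q'$2$3) - (e * q'$1$3) * (e * q'$2$1) = 1"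
      using \<open>e * e * D = 1\<close> by (simp add: D_def algebra_simps)
    have "diagonal_forms (e * q'$1$1) (e * q'$1$3) (e * q'$2$1) (e * q'$2$3)
        = (\<chi> i j. e * q'$i$j)"
      using \<open>\<And>i. q' $ i $ 2 = 0\<close> by (simp add: forms_eq_iff)
    then show "conjugate f \<phi> = proj_point
        (diagonal_forms (e * q'$1$1) (e * q'$1$3) (e * q'$2$1) (e * q'$2$3))"
      using proj_point_scale[OF \<open>e \<noteq> 0\<close>] q(2) by (simp add: conjugate_proj_point q'_def)
  qed
qed

section \<open>Zariski density of integral matrices of determinant 1\<close>

text \<open>
  The restriction of the form to the line is a polynomial in one variable with infinitely many
  zeros, because the integers are infinite in characteristic 0.
\<close>

lemma homogeneous_poly_vanishes_on_line:
  fixes P :: "('a::field_char_0) forms \<Rightarrow> 'a"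
  assumes "homogeneous_poly d P" and "\<And>n::int. P (\<chi> i j. u$i$j + of_int n * v$i$j) = 0"
  shows "P (\<chi> i j. u$i$j + x * v$i$j) = 0"
proof -
  obtain M :: "(nat^3^2) set" and c where
    P: "P = (\<lambda>q. \<Sum>m\<in>M. c m * (\<Prod>i\<in>UNIV. \<Prod>j\<in>UNIV. (q$i$j) ^ (m$i$j)))"
    using assms(1) by (auto simp: homogeneous_poly_def)
  define p where "p = (\<Sum>m\<in>M. [:c m:] * (\<Prod>i\<in>UNIV. \<Prod>j\<in>UNIV. [:u$i$j, v$i$j:] ^ (m$i$j)))"
  have p: "poly p x = P (\<chi> i j. u$i$j + x * v$i$j)" for x
    by (simp add: p_def P poly_sum poly_prod)
  have "range (of_int :: int \<Rightarrow> 'a) \<subseteq> {x. poly p x = 0}" using assms(2) by (auto simp: p)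
  moreover have "infinite (range (of_int :: int \<Rightarrow> 'a))"
    by (simp add: finite_image_iff inj_on_def)
  ultimately have "p = 0" using poly_roots_finite finite_subset by blast
  then show ?thesis using p by (metis poly_0)
qed

text \<open>
  The squaring map followed by the product of elementary matrices
  $(1 + x e_{21})(1 + s e_{12})(1 + y e_{21})(1 + t e_{12})$, where $e_{ij}$ are the matrix units.
  Its coefficients are polynomials of degree at most 1 in each of the four parameters separately.
\<close>

definition elementary_forms :: "'a \<Rightarrow> 'a \<Rightarrow> 'a \<Rightarrow> 'a \<Rightarrow> ('a::field) forms" where
  "elementary_forms x s y t =
     diagonal_forms (1 + s * y) (s + t * (1 + s * y))
       (y + x * (1 + s * y)) (1 + y * t + x * (s + t * (1 + s * y)))"

lemma det_elementary:
  fixes x s y t :: "'a::comm_ring_1"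
  shows "(1 + s * y) * (1 + y * t + x * (s + t * (1 + s * y)))
    - (s + t * (1 + s * y)) * (y + x * (1 + s * y)) = 1"
  by (simp add: algebra_simps)

text \<open>
  If the lower left entry $c$ of a matrix of determinant 1 is nonzero, then the matrix is
  $(1 + s e_{12})(1 + c e_{21})(1 + t e_{12})$ for suitable $s$ and $t$. The fourth factor
  $1 + x e_{21}$ serves to make that entry nonzero beforehand.
\<close>

lemma elementary_forms_exist:
  assumes "a * d - b * c = (1::'a::field)"
  obtains x s y t where "diagonal_forms a b c d = elementary_forms x s y t"
proof -
  have *: "\<exists>s t. diagonal_forms a b c d = elementary_forms x s (c - x * a) t"
    if "c - x * a \<noteq> 0" for x
  proof -
    define y where "y = c - x * a"
    define s t where "s = (a - 1) / y" and "t = (d - x * b - 1) / y"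
    have "y \<noteq> 0" using that by (simp add: y_def)
    then have a: "1 + s * y = a" and d: "1 + y * t = d - x * b" by (simp_all add: s_def t_def)
    have "y * (s + t * a) = (1 + s * y - 1) + (1 + y * t - 1) * a" by (simp add: algebra_simps)
    also have "\<dots> = (a - 1) + (d - x * b - 1) * a" unfolding a d ..
    also have "\<dots> = a * d - 1 - x * a * b" by (simp add: algebra_simps)
    also have "a * d = b * c + 1" using assms by (simp add: algebra_simps)
    finally have "y * (s + t * a) = y * b" by (simp add: y_def algebra_simps)
    then have b: "s + t * a = b" using \<open>y \<noteq> 0\<close> by simp
    have "elementary_forms x s y t = diagonal_forms a b c d"
      unfolding elementary_forms_def a b d by (simp add: forms_eq_iff y_def)
    then show ?thesis unfolding y_def by metis
  qed
  show thesis
  proof (cases "c = 0")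
    case True
    then have "c - 1 * a \<noteq> 0" using assms by auto
    then show thesis using * that by blast
  next
    case False
    then have "c - 0 * a \<noteq> 0" by simp
    then show thesis using * that by blast
  qed
qed

text \<open>
  The group $\mathrm{SL}_2(\mathbf{Z})$ is Zariski-dense in $\mathrm{SL}_2$: the four parameters
  of the factorisation into elementary matrices are freed from being integers one at a time.
\<close>

lemma homogeneous_poly_vanishes_on_SL2:
  fixes P :: "('a::field_char_0) forms \<Rightarrow> 'a"
  assumes P: "homogeneous_poly n P"
    and int: "\<And>a b c d :: int. a * d - b * c = 1 \<Longrightarrow>
      P (diagonal_forms (of_int a) (of_int b) (of_int c) (of_int d)) = 0"
    and "a * d - b * c = 1"
  shows "P (diagonal_forms a b c d) = 0"
proof -
  \<comment> \<open>The second premise says that \<open>w\<close> is affine; it holds in each of the four parameters.\<close>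
  have line: "P (w x) = 0"
    if "\<And>n::int. P (w (of_int n)) = 0"
      and "\<And>x. w x = (\<chi> i j. w 0 $ i $ j + x * (w 1 $ i $ j - w 0 $ i $ j))" for w x
  proof -
    have "w x = (\<chi> i j. w 0 $ i $ j + x * (\<chi> i j. w 1 $ i $ j - w 0 $ i $ j) $ i $ j)" for x
      using that(2)[of x] by simp
    then show ?thesis
      using homogeneous_poly_vanishes_on_line[OF P, of "w 0" "\<chi> i j. w 1 $ i $ j - w 0 $ i $ j" x]
        that(1) by metis
  qed
  note affine = forms_eq_iff elementary_forms_def algebra_simps
  have 0: "P (elementary_forms (of_int x) (of_int s) (of_int y) (of_int t)) = 0" for x s y t
    using int[OF det_elementary[of s y t x]] by (simp add: elementary_forms_def)
  have 1: "P (elementary_forms x (of_int s) (of_int y) (of_int t)) = 0" for x s y t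
    by (rule line[of "\<lambda>x. elementary_forms x (of_int s) (of_int y) (of_int t)", OF 0]) (simp add: affine)
  have 2: "P (elementary_forms x s (of_int y) (of_int t)) = 0" for x s y t
    by (rule line[of "\<lambda>s. elementary_forms x s (of_int y) (of_int t)", OF 1]) (simp add: affine)
  have 3: "P (elementary_forms x s y (of_int t)) = 0" for x s y t
    by (rule line[of "\<lambda>y. elementary_forms x s y (of_int t)", OF 2]) (simp add: affine)
  have 4: "P (elementary_forms x s y t) = 0" for x s y t
    by (rule line[of "\<lambda>t. elementary_forms x s y t", OF 3]) (simp add: affine)
  show ?thesis using elementary_forms_exist[OF assms(3)] 4 by metis
qed

text \<open>
  By invariance, \<open>F\<close> is determined by its values on diagonal maps of determinant 1. On these the
  resultant is 1, so that \<open>F\<close> is given there by its numerator, a polynomial to which the density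
  of $\mathrm{SL}_2(\mathbf{Z})$ applies.
\<close>

lemma invariant_vanishes:
  fixes F :: "('a::{alg_closed_field, field_char_0}) qmap \<Rightarrow> 'a"
  assumes F: "F \<in> PGL2_invariants"
    and int: "\<And>a b c d :: int. a * d - b * c = 1 \<Longrightarrow>
      F (proj_point (diagonal_forms (of_int a) (of_int b) (of_int c) (of_int d))) = 0"
  shows "F = (\<lambda>\<phi>\<in>Rat2. 0)"
proof -
  obtain n P where P: "homogeneous_poly (4 * n) P"
    and FP: "\<And>q. resultant q \<noteq> 0 \<Longrightarrow> F (proj_point q) = P q / resultant q ^ n"
    and ext: "F \<in> extensional Rat2"
    and inv: "\<And>f \<phi>. invertible f \<Longrightarrow> \<phi> \<in> Rat2 \<Longrightarrow> F (conjugate f \<phi>) = F \<phi>"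
    using F unfolding PGL2_invariants_def regular_functions_def by blast
  have eval: "F (proj_point (diagonal_forms a b c d)) = P (diagonal_forms a b c d)"
    if "a * d - b * c = 1" for a b c d
    using FP[of "diagonal_forms a b c d"] that by (simp add: resultant_diagonal_forms)
  have "P (diagonal_forms (of_int a) (of_int b) (of_int c) (of_int d)) = 0"
    if "a * d - b * c = 1" for a b c d :: int
  proof -
    have "(of_int a * of_int d - of_int b * of_int c :: 'a) = 1"
      using arg_cong[OF that, of "of_int :: int \<Rightarrow> 'a"] by simp
    from eval[OF this] int[OF that] show ?thesis by simp
  qed
  then have P0: "P (diagonal_forms a b c d) = 0" if "a * d - b * c = 1" for a b c d
    using homogeneous_poly_vanishes_on_SL2[OF P _ that] by blast
  have "F \<phi> = 0" if \<phi>: "\<phi> \<in> Rat2" for \<phi>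
  proof -
    obtain f a b c d where "invertible f" "a * d - b * c = 1"
      "conjugate f \<phi> = proj_point (diagonal_forms a b c d)"
      using conjugate_to_diagonal[OF \<phi>] .
    then show ?thesis using inv[OF _ \<phi>] eval P0 by metis
  qed
  then show ?thesis using ext by (auto simp: extensional_def restrict_def fun_eq_iff)
qed



section \<open>Valuation rings at non-Archimedean places\<close>

text \<open>
  The members of a place are powers of each other with positive exponents, so one of them already
  determines the integers, the units and the maximal ideal.
\<close>

lemma nonarchimedean_placeE:
  assumes "v \<in> places" and "\<not> archimedean v"
  obtains f where "absolute_value f" and "\<And>x y. f (x + y) \<le> max (f x) (f y)"
    and "integers_at v = {x. f x \<le> 1}" and "units_at v = {x. f x = 1}"
    and "maximal_ideal_at v = {x. f x < 1}"
proof -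
  obtain f where f: "f \<in> nontrivial_absolute_values" and v: "v = equivalent_absolute_values `` {f}"
    using assms(1) by (auto simp: places_def elim: quotientE)
  have abs: "absolute_value f" using f by (simp add: nontrivial_absolute_values_def)
  then have nonneg: "0 \<le> f x" and zero: "f x = 0 \<longleftrightarrow> x = 0" and mult: "f (x * y) = f x * f y" for x y
    by (auto simp: absolute_value_def)
  have "f \<in> v"
    using f nonneg unfolding v equivalent_absolute_values_def by (auto intro!: exI[of _ 1])
  have le: "g x \<le> 1" if g: "g \<in> v" and "f x \<le> 1" for g x
  proof -
    obtain s where s: "s > 0" "g x = f x powr s"
      using g by (auto simp: v equivalent_absolute_values_def)
    have "f x powr s \<le> 1 powr s"
      using that(2) s(1) nonneg by (intro powr_mono2) auto
    then show ?thesis using s by simp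
  qed
  show thesis
  proof (rule that[OF abs])
    show "f (x + y) \<le> max (f x) (f y)" for x y
      using assms(2) \<open>f \<in> v\<close> by (auto simp: archimedean_def)
    show int: "integers_at v = {x. f x \<le> 1}"
      using le \<open>f \<in> v\<close> by (auto simp: integers_at_def)
    have one: "f 1 = 1" using mult[of 1 1] zero[of 1] by simp
    have inv: "f x * f (inverse x) = 1" if "x \<noteq> 0" for x
      using mult[of x "inverse x"] that one by simp
    have "x \<noteq> 0 \<and> f x \<le> 1 \<and> f (inverse x) \<le> 1 \<longleftrightarrow> f x = 1" for x
    proof (cases "x = 0")
      case True
      then show ?thesis using zero[of x] by simp
    next
      case False
      have "f x = 1" if "f x \<le> 1" "f (inverse x) \<le> 1"
        using mult_left_mono[OF that(2) nonneg[of x]] inv[OF False] that(1) by simp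
      then show ?thesis using inv[OF False] False by auto
    qed
    then show units: "units_at v = {x. f x = 1}" by (auto simp: units_at_def int)
    show "maximal_ideal_at v = {x. f x < 1}"
      by (auto simp: maximal_ideal_at_def int units less_le)
  qed
qed

lemma absolute_value_one: "absolute_value f \<Longrightarrow> f 1 = 1"
  unfolding absolute_value_def by (metis mult_cancel_left2 mult_1 zero_neq_one)

lemma absolute_value_minus:
  assumes "absolute_value f"
  shows "f (- x) = f x"
proof -
  have *: "f (x * y) = f x * f y" "0 \<le> f x" for x y
    using assms by (auto simp: absolute_value_def)
  have "f (- 1) * f (- 1) = 1" using *(1)[of "- 1" "- 1"] absolute_value_one[OF assms] by simp
  then have "(f (- 1))\<^sup>2 = 1" by (simp add: power2_eq_square)
  then have "f (- 1) = 1" using *(2)[of "- 1"] by (simp add: power2_eq_1_iff)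
  then show ?thesis using *(1)[of "- 1" x] by simp
qed

lemma ultrametric_of_int_le_1:
  assumes f: "absolute_value f" and ultra: "\<And>x y. f (x + y) \<le> max (f x) (f y)"
  shows "f (of_int n) \<le> 1"
proof -
  have nat: "f (of_nat m) \<le> 1" for m
  proof (induction m)
    case 0
    have "f 0 = 0" using f unfolding absolute_value_def by blast
    then show ?case by simp
  next
    case (Suc m)
    then show ?case using ultra[of 1 "of_nat m"] absolute_value_one[OF f] by simp
  qed
  show ?thesis
    by (cases n rule: int_cases2) (simp_all add: nat absolute_value_minus[OF f])
qed

lemma valuation_ring_simps [simp]:
  "carrier (valuation_ring v) = integers_at v"
  "x \<otimes>\<^bsub>valuation_ring v\<^esub> y = x * y" "x \<oplus>\<^bsub>valuation_ring v\<^esub> y = x + y"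
  "\<one>\<^bsub>valuation_ring v\<^esub> = 1" "\<zero>\<^bsub>valuation_ring v\<^esub> = 0"
  by (simp_all add: valuation_ring_def ring_of_type_algebra_def)

lemma valuation_ring_cring:
  assumes "v \<in> places" and "\<not> archimedean v"
  shows "cring (valuation_ring v)"
proof -
  obtain f where f: "absolute_value f" and ultra: "\<And>x y. f (x + y) \<le> max (f x) (f y)"
    and int: "integers_at v = {x. f x \<le> 1}"
    using nonarchimedean_placeE[OF assms] by metis
  have mult: "f (x * y) = f x * f y" and nonneg: "0 \<le> f x" and zero: "f 0 = 0" for x y
    using f by (auto simp: absolute_value_def)
  have "\<exists>y\<in>integers_at v. y + x = 0" if "x \<in> integers_at v" for x
    using that by (intro bexI[of _ "- x"]) (simp_all add: int absolute_value_minus[OF f])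
  moreover have "x + y \<in> integers_at v" "x * y \<in> integers_at v"
    if "x \<in> integers_at v" "y \<in> integers_at v" for x y
    using that ultra[of x y] by (auto simp: int mult nonneg intro: mult_le_one)
  moreover have "0 \<in> integers_at v" "1 \<in> integers_at v"
    by (simp_all add: int zero absolute_value_one[OF f])
  ultimately show ?thesis
    by (intro cringI abelian_groupI comm_monoidI) (simp_all add: algebra_simps)
qed

lemma valuation_ring_a_inv:
  assumes "v \<in> places" and "\<not> archimedean v" and "x \<in> integers_at v"
  shows "\<ominus>\<^bsub>valuation_ring v\<^esub> x = - x"
proof -
  interpret cring "valuation_ring v" by (rule valuation_ring_cring[OF assms(1,2)])
  show ?thesis using l_neg[of x] assms(3) by (simp add: eq_neg_iff_add_eq_0)
qed

lemma maximal_ideal_at_ideal: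
  assumes "v \<in> places" and "\<not> archimedean v"
  shows "ideal (maximal_ideal_at v) (valuation_ring v)"
proof -
  interpret cring "valuation_ring v" by (rule valuation_ring_cring[OF assms])
  obtain f where f: "absolute_value f" and ultra: "\<And>x y. f (x + y) \<le> max (f x) (f y)"
    and int: "integers_at v = {x. f x \<le> 1}" and max: "maximal_ideal_at v = {x. f x < 1}"
    using nonarchimedean_placeE[OF assms] by metis
  have mult: "f (x * y) = f x * f y" and nonneg: "0 \<le> f x" and zero: "f 0 = 0" for x y
    using f by (auto simp: absolute_value_def)
  note neg = valuation_ring_a_inv[OF assms]
  have prod: "f x * f y < 1" if "f x < 1" "f y \<le> 1" for x y
    using mult_left_mono[OF that(2) nonneg[of x]] that(1) by simp
  show ?thesis
  proof (rule idealI[OF ring_axioms])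
    show "subgroup (maximal_ideal_at v) (add_monoid (valuation_ring v))"
    proof
      show "inv\<^bsub>add_monoid (valuation_ring v)\<^esub> x \<in> maximal_ideal_at v"
        if "x \<in> maximal_ideal_at v" for x
        using that neg[of x] unfolding a_inv_def
        by (simp add: int max absolute_value_minus[OF f])
      show "x \<otimes>\<^bsub>add_monoid (valuation_ring v)\<^esub> y \<in> maximal_ideal_at v"
        if "x \<in> maximal_ideal_at v" "y \<in> maximal_ideal_at v" for x y
        using that ultra[of x y] by (simp add: max)
    qed (auto simp: int max zero)
  next
    fix x y assume "x \<in> maximal_ideal_at v" "y \<in> carrier (valuation_ring v)"
    then show "y \<otimes>\<^bsub>valuation_ring v\<^esub> x \<in> maximal_ideal_at v"
      and "x \<otimes>\<^bsub>valuation_ring v\<^esub> y \<in> maximal_ideal_at v"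
      using prod[of x y] by (simp_all add: int max mult mult.commute)
  qed
qed

section \<open>Good reduction of diagonal maps with unit determinant\<close>

lemma (in cring) form_mult_coeffs:
  assumes c: "\<And>i. c i \<in> carrier R" and d: "\<And>i. d i \<in> carrier R"
  shows "form_mult R c d 0 = c 0 \<otimes> d 0"
    and "form_mult R c d 1 = c 1 \<otimes> d 0 \<oplus> c 0 \<otimes> d 1"
    and "form_mult R c d 2 = c 2 \<otimes> d 0 \<oplus> (c 1 \<otimes> d 1 \<oplus> c 0 \<otimes> d 2)"
  using assms by (simp_all add: form_mult_def Pi_def numeral_2_eq_2)

lemma binary_forms_coeff_closed:
  assumes "cring R" "c \<in> binary_forms R d"
  shows "c i \<in> carrier R"
proof -
  interpret cring R by fact
  show ?thesis using assms(2) by (cases "i \<le> d") (auto simp: binary_forms_def)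
qed

lemma (in cring) zero_in_common_factor_degrees:
  assumes "A \<in> binary_forms R 2" "B \<in> binary_forms R 2"
  shows "0 \<in> common_factor_degrees R A B"
proof -
  define G where "G i = (if i = (0::nat) then \<one> else \<zero>)" for i
  have mult: "form_mult R G C = C" if "C \<in> binary_forms R 2" for C
  proof
    fix k
    have C: "C i \<in> carrier R" for i by (rule binary_forms_coeff_closed[OF is_cring that])
    have "form_mult R G C k = (\<Oplus>i\<in>{..k}. if 0 = i then C (k - i) else \<zero>)"
      unfolding form_mult_def by (rule finsum_cong') (auto simp: G_def C)
    also have "\<dots> = C (k - 0)" by (rule finsum_singleton) (auto simp: C)
    finally show "form_mult R G C k = C k" by simp
  qed
  have "G \<in> binary_forms R 0" by (auto simp: G_def binary_forms_def)
  then show ?thesis using assms mult unfolding common_factor_degrees_def by force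
qed

text \<open>
  Suppose that $G$, of positive degree, divides both forms, with cofactors $a$ and $b$ of degree at
  most 1. The determinant of the diagonal coefficients is then
  $G_0 G_1 (a_0 b_1 - a_1 b_0) = G_1 (a_0 (Gb)_1 - b_0 (Ga)_1)$, and it is zero because the middle
  coefficients $(Ga)_1$ and $(Gb)_1$ vanish.
\<close>

lemma (in cring) common_factor_degrees_diagonal:
  assumes A: "A \<in> binary_forms R 2" "A 1 = \<zero>" and B: "B \<in> binary_forms R 2" "B 1 = \<zero>"
    and det: "A 0 \<otimes> B 2 \<ominus> A 2 \<otimes> B 0 \<noteq> \<zero>"
  shows "common_factor_degrees R A B = {0}"
proof -
  have "e = 0" if e: "e \<in> common_factor_degrees R A B" for e
  proof (rule ccontr)
    assume "e \<noteq> 0"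
    obtain G a b where G: "G \<in> binary_forms R e" and a: "a \<in> binary_forms R (2 - e)"
      and b: "b \<in> binary_forms R (2 - e)" and AB: "A = form_mult R G a" "B = form_mult R G b"
      using e by (auto simp: common_factor_degrees_def)
    have car: "G i \<in> carrier R" "a i \<in> carrier R" "b i \<in> carrier R" for i
      using G a b by (auto intro: binary_forms_coeff_closed[OF is_cring])
    have top: "a 2 = \<zero>" "b 2 = \<zero>" using a b \<open>e \<noteq> 0\<close> by (auto simp: binary_forms_def)
    have mid: "G 1 \<otimes> a 0 \<oplus> G 0 \<otimes> a 1 = \<zero>" "G 1 \<otimes> b 0 \<oplus> G 0 \<otimes> b 1 = \<zero>"
      using A(2) B(2) unfolding AB form_mult_coeffs[OF car(1,2)] form_mult_coeffs[OF car(1,3)] by simp_all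
    have "A 0 \<otimes> B 2 \<ominus> A 2 \<otimes> B 0
        = G 0 \<otimes> a 0 \<otimes> (G 2 \<otimes> b 0 \<oplus> G 1 \<otimes> b 1) \<ominus> (G 2 \<otimes> a 0 \<oplus> G 1 \<otimes> a 1) \<otimes> (G 0 \<otimes> b 0)"
      unfolding AB form_mult_coeffs[OF car(1,2)] form_mult_coeffs[OF car(1,3)]
      by (simp add: top car)
    also have "\<dots> = G 1 \<otimes> (a 0 \<otimes> (G 1 \<otimes> b 0 \<oplus> G 0 \<otimes> b 1) \<ominus> b 0 \<otimes> (G 1 \<otimes> a 0 \<oplus> G 0 \<otimes> a 1))"
      using car[of 0] car[of 1] car[of 2] by algebra
    also have "\<dots> = \<zero>" unfolding mid using car by (simp add: minus_eq)
    finally show False using det by simp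
  qed
  then show ?thesis using zero_in_common_factor_degrees[OF A(1) B(1)] by blast
qed

lemma map_degree_reduced_diagonal:
  assumes v: "v \<in> places" "\<not> archimedean v"
    and int: "a \<in> integers_at v" "b \<in> integers_at v" "c \<in> integers_at v" "d \<in> integers_at v"
    and det: "a * d - b * c \<in> units_at v"
  shows "map_degree (residue_field v) (reduced_form v (diagonal_forms a b c d $ 1))
    (reduced_form v (diagonal_forms a b c d $ 2)) = 2"
proof -
  let ?O = "valuation_ring v" and ?F = "residue_field v" and ?m = "maximal_ideal_at v"
  interpret O: cring ?O by (rule valuation_ring_cring[OF v])
  interpret I: ideal ?m ?O by (rule maximal_ideal_at_ideal[OF v])
  interpret h: ring_hom_cring ?O ?F "residue_at v"
    using I.rcos_ring_hom_cring[OF O.is_cring]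
    unfolding residue_field_def residue_at_def[abs_def] .
  have car: "residue_at v x \<in> carrier ?F" if "x \<in> integers_at v" for x
    using h.hom_closed that by simp
  have zero: "residue_at v 0 = \<zero>\<^bsub>?F\<^esub>" using h.hom_zero by simp
  have res_mult: "residue_at v (x * y) = residue_at v x \<otimes>\<^bsub>?F\<^esub> residue_at v y"
    if "x \<in> integers_at v" "y \<in> integers_at v" for x y
    using h.hom_mult[of x y] that by simp
  have res_diff: "residue_at v (x - y) = residue_at v x \<ominus>\<^bsub>?F\<^esub> residue_at v y"
    if "x \<in> integers_at v" "y \<in> integers_at v" for x y
  proof -
    have "- y \<in> integers_at v"
      using O.a_inv_closed[of y] valuation_ring_a_inv[OF v, of y] that by simp
    then have "residue_at v (x + - y) = residue_at v x \<oplus>\<^bsub>?F\<^esub> residue_at v (- y)"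
      using h.hom_add[of x "- y"] that by simp
    moreover have "residue_at v (- y) = \<ominus>\<^bsub>?F\<^esub> residue_at v y"
      using h.hom_a_inv[of y] valuation_ring_a_inv[OF v, of y] that by simp
    ultimately show ?thesis by (simp add: h.S.minus_eq)
  qed
  have "0 \<in> integers_at v" using O.zero_closed by simp
  note car = car car[OF this]
  have closed: "x * y \<in> integers_at v" if "x \<in> integers_at v" "y \<in> integers_at v" for x y
    using O.m_closed[of x y] that by simp
  have det_int: "a * d - b * c \<in> integers_at v" using det by (simp add: units_at_def)
  have "residue_at v (a * d - b * c) \<noteq> \<zero>\<^bsub>?F\<^esub>"
  proof
    assume "residue_at v (a * d - b * c) = \<zero>\<^bsub>?F\<^esub>"
    then have "residue_at v (a * d - b * c) = ?m" by (simp add: residue_field_def FactRing_def)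
    moreover have "a * d - b * c \<in> residue_at v (a * d - b * c)"
      unfolding residue_at_def using I.a_rcos_self det_int by simp
    ultimately show False using det by (simp add: maximal_ideal_at_def)
  qed
  moreover have "residue_at v (a * d - b * c) = residue_at v a \<otimes>\<^bsub>?F\<^esub> residue_at v d
      \<ominus>\<^bsub>?F\<^esub> residue_at v b \<otimes>\<^bsub>?F\<^esub> residue_at v c"
    using res_diff res_mult closed int by simp
  ultimately have "common_factor_degrees ?F (reduced_form v (diagonal_forms a b c d $ 1))
      (reduced_form v (diagonal_forms a b c d $ 2)) = {0}"
    by (intro h.S.common_factor_degrees_diagonal)
      (auto simp: binary_forms_def reduced_form_def car int zero le_Suc_eq numeral_2_eq_2)
  then show ?thesis by (simp add: map_degree_def)
qed

text \<open>
  The given coefficient vector is already normalized. Any other normalized vector of the same map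
  is a multiple of it by a unit \<open>e\<close>, and so again has integral coefficients and unit determinant.
  Hence the map itself has a reduction of degree 2, and the identity serves as the change of coordinates.
\<close>

lemma good_reduction_diagonal_forms:
  assumes v: "v \<in> places" "\<not> archimedean v"
    and int: "a \<in> integers_at v" "b \<in> integers_at v" "c \<in> integers_at v" "d \<in> integers_at v"
    and det: "a * d - b * c \<in> units_at v"
  shows "good_reduction v (proj_point (diagonal_forms a b c d))"
proof -
  let ?q = "diagonal_forms a b c d"
  let ?\<phi> = "proj_point ?q"
  obtain f where f: "absolute_value f" and ultra: "\<And>x y. f (x + y) \<le> max (f x) (f y)"
    and O: "integers_at v = {x. f x \<le> 1}" and U: "units_at v = {x. f x = 1}"
    using nonarchimedean_placeE[OF v] by metis
  have mult: "f (x * y) = f x * f y" and nonneg: "0 \<le> f x" and zero: "f x = 0 \<longleftrightarrow> x = 0" for x y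
    using f by (auto simp: absolute_value_def)
  have diff: "f (x - y) \<le> max (f x) (f y)" for x y
    using ultra[of x "- y"] by (simp add: absolute_value_minus[OF f])
  have int': "f a \<le> 1" "f b \<le> 1" "f c \<le> 1" "f d \<le> 1" using int by (simp_all add: O)
  have det': "f (a * d - b * c) = 1" using det by (simp add: U)
  have q_int: "f (?q$i$j) \<le> 1" for i j
    using int' zero[of 0] exhaust_2[of i] exhaust_3[of j] by auto
  have "f a = 1 \<or> f b = 1"
  proof (rule ccontr)
    assume "\<not> (f a = 1 \<or> f b = 1)"
    then have "f a < 1" "f b < 1" using int' by auto
    then have "f (a * d) < 1" "f (b * c) < 1"
      using int' mult_left_mono[OF int'(4) nonneg[of a]] mult_left_mono[OF int'(3) nonneg[of b]]
      by (simp_all add: mult)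
    then show False using diff[of "a * d" "b * c"] det' by simp
  qed
  then have "\<exists>i j. f (?q$i$j) = 1" by (metis diagonal_forms_nth(1,3))
  then have "normalized_at v ?q" using q_int by (simp add: normalized_at_def O U)
  moreover have "?q \<in> ?\<phi>"
    unfolding proj_point_def by (auto intro!: exI[of _ 1])
  ultimately have ex: "\<exists>q. q \<in> ?\<phi> \<and> normalized_at v q" by blast
  define q where "q = (SOME q. q \<in> ?\<phi> \<and> normalized_at v q)"
  have q: "q \<in> ?\<phi>" "normalized_at v q" using someI_ex[OF ex] by (auto simp: q_def)
  obtain e where "e \<noteq> 0" and e: "q = (\<chi> i j. e * ?q$i$j)" using q(1) by (auto simp: proj_point_def)
  have q_eq: "q = diagonal_forms (e * a) (e * b) (e * c) (e * d)"
    unfolding e by (simp add: forms_eq_iff)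
  have e_int: "f (e * a) \<le> 1" "f (e * b) \<le> 1" "f (e * c) \<le> 1" "f (e * d) \<le> 1"
    using q(2) unfolding normalized_at_def O q_eq
    by (metis diagonal_forms_nth mem_Collect_eq)+
  \<comment> \<open>Writing \<open>e\<close> as \<open>e * (a * d - b * c)\<close> bounds \<open>f e\<close> from above; a unit coefficient \<open>e * q$i$j\<close> bounds it from below.\<close>
  have "f e = 1"
  proof (rule antisym)
    have "f e = f (e * a * d - e * b * c)"
      using det' mult[of e "a * d - b * c"] by (simp add: algebra_simps)
    also have "\<dots> \<le> max (f (e * a * d)) (f (e * b * c))" by (rule diff)
    also have "\<dots> \<le> 1"
      unfolding mult[of "e * a"] mult[of "e * b"] using e_int int' nonneg by (simp add: mult_le_one)
    finally show "f e \<le> 1" .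
    obtain i j where "f (e * ?q$i$j) = 1" using q(2) by (auto simp: normalized_at_def U e)
    then show "1 \<le> f e" using mult_left_mono[OF q_int nonneg, of e i j] by (simp add: mult)
  qed
  then have "f ((e * a) * (e * d) - (e * b) * (e * c)) = 1"
    using det' mult[of "e * e" "a * d - b * c"] by (simp add: algebra_simps mult)
  then have "reduction_degree v ?\<phi> = 2"
    using map_degree_reduced_diagonal[OF v, of "e * a" "e * b" "e * c" "e * d"] e_int
    by (simp add: reduction_degree_def q_def[symmetric] q_eq O U)
  moreover have "?\<phi> \<in> Rat2"
    using det' zero[of 0] by (auto simp: Rat2_def resultant_diagonal_forms)
  moreover have "isomorphic_maps ?\<phi> ?\<phi>"
  proof -
    have inv: "invertible (mat 1 :: 'a^2^2)" by (simp add: invertible_def)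
    have "sym2 (mat 1 :: 'a^2^2) = mat 1"
      by (simp add: vec_eq_iff forall_3 sym2_def mat_def)
    then have "conjugate (mat 1) ?\<phi> = ?\<phi>"
      using matrix_inv_left[OF inv] by (simp add: conjugate_proj_point)
    then show ?thesis unfolding isomorphic_maps_def using inv by metis
  qed
  ultimately show ?thesis unfolding good_reduction_def by blast
qed

section \<open>Points of the moduli space and its Zariski topology\<close>

lemma base_change_proj_point:
  "base_change (proj_point q) = proj_point (\<chi> i j. to_ac (q$i$j))"
proof -
  have "proj_point (\<chi> i j. to_ac (c * q$i$j)) = proj_point (\<chi> i j. to_ac (q$i$j))"
    if "c \<noteq> 0" for c
    using proj_point_scale[of "to_ac c" "\<chi> i j. to_ac (q$i$j)"] that by simp
  then show ?thesis
    unfolding base_change_def proj_point_def[of q] by (auto intro!: exI[of _ 1] simp del: to_ac_mult)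
qed

lemma base_change_diagonal_forms:
  "base_change (proj_point (diagonal_forms a b c d))
     = proj_point (diagonal_forms (to_ac a) (to_ac b) (to_ac c) (to_ac d))"
proof -
  have "(\<chi> i j. to_ac (diagonal_forms a b c d $ i $ j))
      = diagonal_forms (to_ac a) (to_ac b) (to_ac c) (to_ac d)"
    by (simp add: forms_eq_iff)
  then show ?thesis by (simp add: base_change_proj_point)
qed

text \<open>
  Evaluation at \<open>\<phi>\<close> is a homomorphism from the invariant ring to a field, and the moduli point is
  its kernel.
\<close>

lemma moduli_point_prime:
  fixes \<phi> :: "('a::alg_closed_field) qmap"
  assumes "cring (invariant_ring :: ('a qmap \<Rightarrow> 'a) ring)" and \<phi>: "\<phi> \<in> Rat2"
  shows "moduli_point \<phi> \<in> spec invariant_ring"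
proof -
  let ?R = "invariant_ring :: ('a qmap \<Rightarrow> 'a) ring"
  interpret cring ?R by fact
  have simps: "carrier ?R = PGL2_invariants" "(F \<otimes>\<^bsub>?R\<^esub> G) \<phi> = F \<phi> * G \<phi>"
    "(F \<oplus>\<^bsub>?R\<^esub> G) \<phi> = F \<phi> + G \<phi>" "\<one>\<^bsub>?R\<^esub> \<phi> = 1" "\<zero>\<^bsub>?R\<^esub> \<phi> = 0" for F G
    using \<phi> by (simp_all add: invariant_ring_def)
  have mem: "F \<in> moduli_point \<phi> \<longleftrightarrow> F \<in> carrier ?R \<and> F \<phi> = 0" for F
    by (simp add: moduli_point_def simps)
  have neg: "(\<ominus>\<^bsub>?R\<^esub> F) \<phi> = - F \<phi>" if "F \<in> carrier ?R" for F
    using arg_cong[OF l_neg[OF that], of "\<lambda>G. G \<phi>"] by (simp add: simps eq_neg_iff_add_eq_0)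
  have "ideal (moduli_point \<phi>) ?R"
  proof (rule idealI[OF ring_axioms])
    show "subgroup (moduli_point \<phi>) (add_monoid ?R)"
    proof
      show "inv\<^bsub>add_monoid ?R\<^esub> F \<in> moduli_point \<phi>" if "F \<in> moduli_point \<phi>" for F
        using that neg[of F] a_inv_closed[of F] by (simp add: mem a_inv_def)
    qed (auto simp: mem simps(2-))
  qed (simp_all add: mem simps(2-))
  moreover have "carrier ?R \<noteq> moduli_point \<phi>" using mem[of "\<one>\<^bsub>?R\<^esub>"] simps(4) by auto
  ultimately have "primeideal (moduli_point \<phi>) ?R"
    by (rule primeidealI[OF _ is_cring]) (simp add: mem simps(2-))
  then show ?thesis by (simp add: spec_def)
qed

lemma openin_zariski_topology:
  "openin (zariski_topology R) U \<longleftrightarrow> (\<exists>E\<subseteq>carrier R. U = spec R - {p \<in> spec R. E \<subseteq> p})"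
  unfolding zariski_topology_def by (simp only: topology_inverse'[OF istopology_zariski])

lemma topspace_zariski_topology: "topspace (zariski_topology R) = spec R"
proof
  show "topspace (zariski_topology R) \<subseteq> spec R"
    unfolding topspace_def by (auto simp: openin_zariski_topology)
  have "\<not> carrier R \<subseteq> p" if "p \<in> spec R" for p
  proof -
    interpret primeideal p R using that by (simp add: spec_def)
    show ?thesis using I_notcarr a_subset by blast
  qed
  then have "openin (zariski_topology R) (spec R)"
    unfolding openin_zariski_topology by (intro exI[of _ "carrier R"]) blast
  then show "spec R \<subseteq> topspace (zariski_topology R)" by (rule openin_subset)
qed

text \<open>
  A closed set $V(E)$ containing \<open>Z\<close> has all of $E$ contained in every member of \<open>Z\<close>, so that
  $E$ contains nothing but zero and $V(E)$ is the whole spectrum.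
\<close>

lemma zariski_dense_if_vanishing_trivial:
  assumes "Z \<subseteq> spec R"
    and "\<And>x. x \<in> carrier R \<Longrightarrow> (\<And>z. z \<in> Z \<Longrightarrow> x \<in> z) \<Longrightarrow> x = \<zero>\<^bsub>R\<^esub>"
  shows "zariski_topology R closure_of Z = topspace (zariski_topology R)"
proof -
  have "\<exists>z\<in>Z. z \<in> U" if p: "p \<in> spec R" and U: "p \<in> U" "openin (zariski_topology R) U" for p U
  proof -
    interpret primeideal p R using p by (simp add: spec_def)
    obtain E where E: "E \<subseteq> carrier R" "U = spec R - {p \<in> spec R. E \<subseteq> p}"
      using U(2) by (auto simp: openin_zariski_topology)
    then obtain x where x: "x \<in> E" "x \<notin> p" using U(1) by blast
    then have "x \<noteq> \<zero>\<^bsub>R\<^esub>" using additive_subgroup.zero_closed[OF additive_subgroup_axioms] by blast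
    then obtain z where "z \<in> Z" "x \<notin> z" using assms(2) x(1) E(1) by blast
    then show ?thesis using x(1) E(2) assms(1) by blast
  qed
  then show ?thesis
    unfolding closure_of_def topspace_zariski_topology by blast
qed

theorem theorem1:
  fixes S :: "('k::number_field) place set"
  assumes "S \<subseteq> places" and "finite S" and "{v \<in> places. archimedean v} \<subseteq> S"
  shows "moduli_space closure_of (good_reduction_locus S) = topspace moduli_space"
proof (cases "spec (invariant_ring :: ('k alg_closure qmap \<Rightarrow> 'k alg_closure) ring) = {}")
  case True
  then show ?thesis
    by (simp add: moduli_space_def topspace_zariski_topology closure_of_def)
next
  \<comment> \<open>Any point of the spectrum is a prime ideal of a commutative ring, which provides the ring laws.\<close>
  case False
  let ?R = "invariant_ring :: ('k alg_closure qmap \<Rightarrow> 'k alg_closure) ring"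
  have cring: "cring ?R" using False by (auto simp: spec_def primeideal_def)
  have base_change: "base_change \<phi> \<in> Rat2" if \<phi>: "\<phi> \<in> Rat2" for \<phi> :: "'k qmap"
  proof -
    obtain q where q: "resultant q \<noteq> 0" "\<phi> = proj_point q" using \<phi> by (auto simp: Rat2_def)
    have "resultant (\<chi> i j. to_ac (q$i$j)) = to_ac (resultant q)"
      by (simp add: resultant_eq)
    then show ?thesis using q by (auto simp: Rat2_def base_change_proj_point)
  qed
  show ?thesis
    unfolding moduli_space_def
  proof (rule zariski_dense_if_vanishing_trivial)
    show "good_reduction_locus S \<subseteq> spec ?R"
      using moduli_point_prime[OF cring base_change] by (auto simp: good_reduction_locus_def)
  next
    fix F assume F: "F \<in> carrier ?R" and vanish: "\<And>p. p \<in> good_reduction_locus S \<Longrightarrow> F \<in> p"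
    have "F (proj_point (diagonal_forms (of_int a) (of_int b) (of_int c) (of_int d))) = 0"
      if det: "a * d - b * c = 1" for a b c d :: int
    proof -
      let ?\<phi> = "proj_point (diagonal_forms (of_int a) (of_int b) (of_int c) (of_int d)) :: 'k qmap"
      have det': "of_int a * of_int d - of_int b * of_int c = (1::'k)"
        using arg_cong[OF det, of of_int] by simp
      have "good_reduction v ?\<phi>" if "v \<in> places - S" for v
      proof -
        have v: "v \<in> places" "\<not> archimedean v" using that assms(3) by auto
        obtain f where f: "absolute_value f" "\<And>x y. f (x + y) \<le> max (f x) (f y)"
          and int: "integers_at v = {x. f x \<le> 1}" and units: "units_at v = {x. f x = 1}"
          using nonarchimedean_placeE[OF v] by metis
        have "of_int n \<in> integers_at v" for n
          using ultrametric_of_int_le_1[OF f] by (simp add: int)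
        moreover have "1 \<in> units_at v"
          using absolute_value_one[OF f(1)] by (simp add: units)
        ultimately show ?thesis using good_reduction_diagonal_forms[OF v] by (simp add: det')
      qed
      moreover have "?\<phi> \<in> Rat2"
        using det' by (auto simp: Rat2_def resultant_diagonal_forms)
      ultimately have "moduli_point (base_change ?\<phi>) \<in> good_reduction_locus S"
        by (auto simp: good_reduction_locus_def)
      then have "F (base_change ?\<phi>) = 0" using vanish by (auto simp: moduli_point_def)
      then show ?thesis by (simp add: base_change_diagonal_forms)
    qed
    then show "F = \<zero>\<^bsub>?R\<^esub>"
      using invariant_vanishes[of F] F by (simp add: invariant_ring_def)
  qed
qed

end
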